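(* Let $g$ be a $C^1$ function near $0\in\mathbb{C}$ with $g(0)=0$, $g_z(0)=0$, $g_{\bar z}(0)=1$, such that $z^2$ and $g^2$ separate points near $0$. Let $F(w_1,w_2)$ be an odd holomorphic function near the origin of $\mathbb{C}^2$ with $F(w_1,w_2)=O(\|(w_1,w_2)\|^3)$, and write $(g+F(z,g))(z)=g(z)+F(z,g(z))$. Then for every closed disk $D$ centered at $0$ with sufficiently small radius, $$[\,z^2,\ g^2\,;\,D\,]=C(D)\iff[\,z^2,\ (g+F(z,g))^2\,;\,D\,]=C(D).$$
   Context: For continuous functions $f_1,f_2$ on a compact set $D\subset\mathbb{C}$, $[f_1,f_2;D]$ denotes the uniform closure in $C(D)$ of the set of polynomials (with complex coefficients) in $f_1$ and $f_2$. *)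

theory Defs
  imports "HOL-Analysis.Analysis"
begin

definition C1_near :: "(complex \<Rightarrow> complex) \<Rightarrow> complex \<Rightarrow> bool" where
  "C1_near g a \<longleftrightarrow> (\<exists>r>0. \<exists>Dg :: complex \<Rightarrow> (complex \<Rightarrow>\<^sub>L complex).
      (\<forall>z\<in>ball a r. (g has_derivative blinfun_apply (Dg z)) (at z)) \<and>
      continuous_on (ball a r) Dg)"

definition wirtinger_z :: "(complex \<Rightarrow> complex) \<Rightarrow> complex \<Rightarrow> complex" where
  "wirtinger_z g a = (frechet_derivative g (at a) 1 - \<i> * frechet_derivative g (at a) \<i>) / 2"

definition wirtinger_zbar :: "(complex \<Rightarrow> complex) \<Rightarrow> complex \<Rightarrow> complex" where
  "wirtinger_zbar g a = (frechet_derivative g (at a) 1 + \<i> * frechet_derivative g (at a) \<i>) / 2"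

definition separate_points_near0 :: "(complex \<Rightarrow> complex) \<Rightarrow> (complex \<Rightarrow> complex) \<Rightarrow> bool" where
  "separate_points_near0 f1 f2 \<longleftrightarrow> (\<exists>r>0. \<forall>z\<in>ball 0 r. \<forall>w\<in>ball 0 r.
      f1 z = f1 w \<and> f2 z = f2 w \<longrightarrow> z = w)"

definition holomorphic2_near0 :: "(complex \<times> complex \<Rightarrow> complex) \<Rightarrow> bool" where
  "holomorphic2_near0 F \<longleftrightarrow> (\<exists>r>0. \<forall>p\<in>ball 0 r. \<exists>F'.
      (F has_derivative F') (at p) \<and> (\<forall>c a b. F' (c * a, c * b) = c * F' (a, b)))"

definition odd_near0 :: "(complex \<times> complex \<Rightarrow> complex) \<Rightarrow> bool" where
  "odd_near0 F \<longleftrightarrow> (\<exists>r>0. \<forall>p\<in>ball 0 r. F (- p) = - F p)"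

definition bigO_cube_near0 :: "(complex \<times> complex \<Rightarrow> complex) \<Rightarrow> bool" where
  "bigO_cube_near0 F \<longleftrightarrow> (\<exists>C r. r > 0 \<and> (\<forall>p\<in>ball 0 r. norm (F p) \<le> C * norm p ^ 3))"

definition poly_algebra_dense :: "(complex \<Rightarrow> complex) \<Rightarrow> (complex \<Rightarrow> complex) \<Rightarrow> complex set \<Rightarrow> bool" where
  "poly_algebra_dense f1 f2 D \<longleftrightarrow> (\<forall>h. continuous_on D h \<longrightarrow> (\<forall>\<epsilon>>0. \<exists>N c.
      \<forall>z\<in>D. norm (h z - (\<Sum>i\<le>N. \<Sum>j\<le>N. c i j * f1 z ^ i * f2 z ^ j)) < \<epsilon>))"

end

theory Submission
  imports Defs "HOL-Complex_Analysis.Complex_Analysis"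
begin

text \<open>
  Let \<open>k\<close> be \<open>g\<close> or \<open>h = g + F(z, g)\<close> and let \<open>A\<^sub>k\<close> be the closed algebra generated by \<open>z\<^sup>2\<close>
  and \<open>k\<^sup>2\<close> on a small disc. As \<open>z k\<close> is close to \<open>\<bar>z\<bar>\<^sup>2\<close>, it takes values in a narrow sector around
  the positive axis, where it is the square root of \<open>z\<^sup>2 k\<^sup>2\<close>, hence a uniform limit of polynomials
  in \<open>z\<^sup>2 k\<^sup>2\<close>; so \<open>A\<^sub>k\<close> contains all even polynomials in \<open>z\<close> and \<open>k\<close>. Let \<open>B\<^sub>k\<close> be the closure of
  \<open>z A\<^sub>k + k A\<^sub>k\<close>, which plays the role of the odd functions. Since \<open>F\<close> is a uniform limit of odd
  polynomials, \<open>h\<close> lies in \<open>B\<^sub>g\<close>; since \<open>g\<close> is the fixed point of the contraction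
  \<open>u \<mapsto> h - F(z, u)\<close>, which preserves \<open>B\<^sub>h\<close>, it lies in \<open>B\<^sub>h\<close>. Products of two odd functions being
  even, \<open>A\<^sub>g = A\<^sub>h\<close>.
\<close>

section \<open>Uniformly closed algebras of bounded functions\<close>

text \<open>Functions are total and only their values on \<open>D\<close> count: whatever agrees on
  \<open>D\<close> with a limit is itself in the closure. This replaces restriction to
  \<open>D\<close>.\<close>

definition uniform_closure_on :: "'a set \<Rightarrow> ('a \<Rightarrow> complex) set \<Rightarrow> ('a \<Rightarrow> complex) set" where
  "uniform_closure_on D P = {f. \<forall>\<epsilon>>0. \<exists>p\<in>P. \<forall>z\<in>D. norm (f z - p z) < \<epsilon>}"

lemma uniform_closure_onI:
  "(\<And>\<epsilon>. \<epsilon> > 0 \<Longrightarrow> \<exists>p\<in>P. \<forall>z\<in>D. norm (f z - p z) < \<epsilon>) \<Longrightarrow> f \<in> uniform_closure_on D P"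
  by (auto simp: uniform_closure_on_def)

lemma uniform_closure_onE:
  assumes "f \<in> uniform_closure_on D P" "\<epsilon> > 0"
  obtains p where "p \<in> P" "\<And>z. z \<in> D \<Longrightarrow> norm (f z - p z) < \<epsilon>"
  using assms by (auto simp: uniform_closure_on_def)

lemma subset_uniform_closure_on: "P \<subseteq> uniform_closure_on D P"
  by (force intro: uniform_closure_onI)

lemma uniform_closure_on_idem:
  "uniform_closure_on D (uniform_closure_on D P) = uniform_closure_on D P"
proof
  show "uniform_closure_on D (uniform_closure_on D P) \<subseteq> uniform_closure_on D P"
  proof
    fix f assume f: "f \<in> uniform_closure_on D (uniform_closure_on D P)"
    show "f \<in> uniform_closure_on D P"
    proof (rule uniform_closure_onI)
      fix \<epsilon> :: real assume "\<epsilon> > 0"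
      then have e: "\<epsilon>/2 > 0" by simp
      obtain q where q: "q \<in> uniform_closure_on D P" "\<And>z. z \<in> D \<Longrightarrow> norm (f z - q z) < \<epsilon>/2"
        using uniform_closure_onE[OF f e] by blast
      obtain p where p: "p \<in> P" "\<And>z. z \<in> D \<Longrightarrow> norm (q z - p z) < \<epsilon>/2"
        using uniform_closure_onE[OF q(1) e] by blast
      have "norm (f z - p z) < \<epsilon>" if "z \<in> D" for z
        using norm_triangle_ineq[of "f z - q z" "q z - p z"] q(2)[OF that] p(2)[OF that] by simp
      with p(1) show "\<exists>p\<in>P. \<forall>z\<in>D. norm (f z - p z) < \<epsilon>" by blast
    qed
  qed
qed (rule subset_uniform_closure_on)

lemma uniform_closure_on_mono: "P \<subseteq> Q \<Longrightarrow> uniform_closure_on D P \<subseteq> uniform_closure_on D Q"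
  unfolding uniform_closure_on_def by blast

text \<open>Boundedness on \<open>D\<close> is what lets products pass to uniform limits.\<close>

definition bounded_functions_on :: "'a set \<Rightarrow> ('a \<Rightarrow> complex) set" where
  "bounded_functions_on D = {f. bounded (f ` D)}"

lemma bounded_functions_onE:
  assumes "f \<in> bounded_functions_on D"
  obtains M where "M > 0" "\<And>z. z \<in> D \<Longrightarrow> norm (f z) \<le> M"
  using assms by (auto simp: bounded_functions_on_def bounded_pos)

lemma bounded_functions_onI:
  "(\<And>z. z \<in> D \<Longrightarrow> norm (f z) \<le> M) \<Longrightarrow> f \<in> bounded_functions_on D"
  by (auto simp: bounded_functions_on_def bounded_iff)

lemma bounded_functions_on_add:
  assumes "f \<in> bounded_functions_on D" "g \<in> bounded_functions_on D"
  shows "(\<lambda>z. f z + g z) \<in> bounded_functions_on D"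
  using assms bounded_plus_comp[of f D g] by (auto simp: bounded_functions_on_def)

lemma bounded_functions_on_mult:
  assumes "f \<in> bounded_functions_on D" "g \<in> bounded_functions_on D"
  shows "(\<lambda>z. f z * g z) \<in> bounded_functions_on D"
proof -
  obtain M N where "M > 0" "N > 0" "\<And>z. z \<in> D \<Longrightarrow> norm (f z) \<le> M" "\<And>z. z \<in> D \<Longrightarrow> norm (g z) \<le> N"
    using assms by (metis bounded_functions_onE)
  then show ?thesis
    by (intro bounded_functions_onI[where M = "M * N"]) (auto simp: norm_mult intro!: mult_mono)
qed

lemma uniform_closure_on_bounded:
  assumes "P \<subseteq> bounded_functions_on D"
  shows "uniform_closure_on D P \<subseteq> bounded_functions_on D"
proof
  fix f assume "f \<in> uniform_closure_on D P"
  then obtain p where p: "p \<in> P" "\<And>z. z \<in> D \<Longrightarrow> norm (f z - p z) < 1"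
    by (rule uniform_closure_onE[where \<epsilon> = 1]) auto
  then obtain M where M: "\<And>z. z \<in> D \<Longrightarrow> norm (p z) \<le> M"
    using assms by (metis bounded_functions_onE subsetD)
  have "norm (f z) \<le> M + 1" if "z \<in> D" for z
    using norm_triangle_ineq[of "f z - p z" "p z"] p(2)[OF that] M[OF that] by simp
  then show "f \<in> bounded_functions_on D" by (rule bounded_functions_onI)
qed

lemma uniform_closure_on_add:
  assumes "\<And>p q. p \<in> P \<Longrightarrow> q \<in> Q \<Longrightarrow> (\<lambda>z. p z + q z) \<in> R"
    and f: "f \<in> uniform_closure_on D P" and g: "g \<in> uniform_closure_on D Q"
  shows "(\<lambda>z. f z + g z) \<in> uniform_closure_on D R"
proof (rule uniform_closure_onI)
  fix \<epsilon> :: real assume "\<epsilon> > 0"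
  then have e: "\<epsilon>/2 > 0" by simp
  obtain p where p: "p \<in> P" "\<And>z. z \<in> D \<Longrightarrow> norm (f z - p z) < \<epsilon>/2"
    using uniform_closure_onE[OF f e] by blast
  obtain q where q: "q \<in> Q" "\<And>z. z \<in> D \<Longrightarrow> norm (g z - q z) < \<epsilon>/2"
    using uniform_closure_onE[OF g e] by blast
  have "norm ((f z + g z) - (p z + q z)) < \<epsilon>" if "z \<in> D" for z
    using norm_triangle_ineq[of "f z - p z" "g z - q z"] p(2)[OF that] q(2)[OF that]
    by (simp add: algebra_simps)
  with assms(1)[OF p(1) q(1)] show "\<exists>r\<in>R. \<forall>z\<in>D. norm (f z + g z - r z) < \<epsilon>"
    by (intro bexI[of _ "\<lambda>z. p z + q z"]) auto
qed

text \<open>Three separate families make one statement serve polynomials, even times odd, and odd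
  times odd.\<close>

lemma uniform_closure_on_mult:
  assumes PQ: "\<And>p q. p \<in> P \<Longrightarrow> q \<in> Q \<Longrightarrow> (\<lambda>z. p z * q z) \<in> R"
    and f: "f \<in> uniform_closure_on D P" and g: "g \<in> uniform_closure_on D Q"
    and P: "P \<subseteq> bounded_functions_on D" and Q: "Q \<subseteq> bounded_functions_on D"
  shows "(\<lambda>z. f z * g z) \<in> uniform_closure_on D R"
proof (rule uniform_closure_onI)
  fix \<epsilon> :: real assume "\<epsilon> > 0"
  obtain M where M: "M > 0" "\<And>z. z \<in> D \<Longrightarrow> norm (g z) \<le> M"
    using g uniform_closure_on_bounded[OF Q] by (metis bounded_functions_onE subsetD)
  have "\<epsilon> / (2 * M) > 0" using \<open>\<epsilon> > 0\<close> M by simp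
  then obtain p where p: "p \<in> P" "\<And>z. z \<in> D \<Longrightarrow> norm (f z - p z) < \<epsilon> / (2 * M)"
    using uniform_closure_onE[OF f] by metis
  \<comment> \<open>The bound is on the approximant \<open>p\<close>, not on \<open>f\<close>, so
    the tolerance for \<open>q\<close> is fixed only after \<open>p\<close> is chosen.\<close>
  obtain N where N: "N > 0" "\<And>z. z \<in> D \<Longrightarrow> norm (p z) \<le> N"
    using p P by (metis bounded_functions_onE subsetD)
  have "\<epsilon> / (2 * N) > 0" using \<open>\<epsilon> > 0\<close> N by simp
  then obtain q where q: "q \<in> Q" "\<And>z. z \<in> D \<Longrightarrow> norm (g z - q z) < \<epsilon> / (2 * N)"
    using uniform_closure_onE[OF g] by metis
  have "norm (f z * g z - p z * q z) < \<epsilon>" if "z \<in> D" for z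
  proof -
    have "f z * g z - p z * q z = (f z - p z) * g z + p z * (g z - q z)" by (simp add: algebra_simps)
    then have "norm (f z * g z - p z * q z) \<le> norm (f z - p z) * norm (g z) + norm (p z) * norm (g z - q z)"
      by (metis norm_mult norm_triangle_ineq)
    also have "\<dots> \<le> norm (f z - p z) * M + N * norm (g z - q z)"
      using M(2)[OF that] N(2)[OF that] by (intro add_mono mult_left_mono mult_right_mono) auto
    also have "\<dots> < \<epsilon> / (2 * M) * M + N * (\<epsilon> / (2 * N))"
      using p(2)[OF that] q(2)[OF that] M(1) N(1) by (intro add_strict_mono mult_strict_right_mono mult_strict_left_mono) auto
    also have "\<dots> = \<epsilon>" using M(1) N(1) by simp
    finally show ?thesis .
  qed
  with PQ[OF p(1) q(1)] show "\<exists>r\<in>R. \<forall>z\<in>D. norm (f z * g z - r z) < \<epsilon>"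
    by (intro bexI[of _ "\<lambda>z. p z * q z"]) auto
qed

section \<open>Uniformly closed algebras, and square roots in them\<close>

locale uniform_algebra_on =
  fixes D :: "'a set" and A :: "('a \<Rightarrow> complex) set"
  assumes const: "(\<lambda>_. c) \<in> A"
    and add: "f \<in> A \<Longrightarrow> g \<in> A \<Longrightarrow> (\<lambda>z. f z + g z) \<in> A"
    and mult: "f \<in> A \<Longrightarrow> g \<in> A \<Longrightarrow> (\<lambda>z. f z * g z) \<in> A"
    and bounded: "A \<subseteq> bounded_functions_on D"
    and closed: "uniform_closure_on D A \<subseteq> A"
begin

lemma cmult: "f \<in> A \<Longrightarrow> (\<lambda>z. c * f z) \<in> A"
  using mult[OF const] .

lemma diff: "f \<in> A \<Longrightarrow> g \<in> A \<Longrightarrow> (\<lambda>z. f z - g z) \<in> A"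
  using add[OF _ cmult[of g "-1"]] by simp

lemma power: "f \<in> A \<Longrightarrow> (\<lambda>z. f z ^ n) \<in> A"
  by (induction n) (auto intro: const mult)

lemma sum: "(\<And>i. i \<in> I \<Longrightarrow> f i \<in> A) \<Longrightarrow> (\<lambda>z. \<Sum>i\<in>I. f i z) \<in> A"
  by (induction I rule: infinite_finite_induct) (auto intro: const add)

lemma limit:
  assumes "\<And>\<epsilon>. \<epsilon> > 0 \<Longrightarrow> \<exists>p\<in>A. \<forall>z\<in>D. norm (f z - p z) < \<epsilon>"
  shows "f \<in> A"
  using closed uniform_closure_onI[of A D f, OF assms] by blast

lemma limit_seq:
  assumes "\<And>n. p n \<in> A" "e \<longlonglongrightarrow> (0::real)"
    and "\<And>n z. z \<in> D \<Longrightarrow> norm (f z - p n z) \<le> e n"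
  shows "f \<in> A"
proof (rule limit)
  fix \<epsilon> :: real assume "\<epsilon> > 0"
  with assms(2) have "eventually (\<lambda>n. e n < \<epsilon>) sequentially"
    by (rule order_tendstoD)
  then obtain n where "e n < \<epsilon>" by (auto simp: eventually_sequentially)
  with assms(1,3) show "\<exists>p\<in>A. \<forall>z\<in>D. norm (f z - p z) < \<epsilon>"
    by (meson le_less_trans)
qed

text \<open>The iteration \<open>u \<mapsto> u + (s\<^sup>2 - u\<^sup>2) / 2\<close> started at \<open>0\<close> multiplies the error \<open>e = s - u\<close>
  by \<open>1 - s + e / 2\<close>, of modulus at most \<open>1 - \<rho> / 3\<close>; as \<open>\<bar>s\<bar> = O(\<rho>)\<close>, the decay
  \<open>\<rho> (1 - \<rho> / 3)\<^sup>n = O(1 / n)\<close> is uniform even where \<open>\<rho>\<close> is small.\<close>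

lemma sqrt_closed:
  assumes sq: "(\<lambda>z. s z ^ 2) \<in> A"
    and \<rho>: "\<And>z. z \<in> D \<Longrightarrow> 0 \<le> \<rho> z" "\<And>z. z \<in> D \<Longrightarrow> \<rho> z \<le> 1"
    and near: "\<And>z. z \<in> D \<Longrightarrow> norm (s z - of_real (\<rho> z)) \<le> \<rho> z / 10"
  shows "s \<in> A"
proof -
  define u where "u = rec_nat (\<lambda>_. 0) (\<lambda>_ v z. v z + (1/2) * (s z ^ 2 - v z ^ 2))"
  have u0: "u 0 = (\<lambda>_. 0)" and uS: "u (Suc n) = (\<lambda>z. u n z + (1/2) * (s z ^ 2 - u n z ^ 2))" for n
    by (simp_all add: u_def)
  have uA: "u n \<in> A" for n
  proof (induction n)
    case 0 then show ?case by (simp add: u0 const)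
  next
    case (Suc n) then show ?case unfolding uS by (intro add cmult diff sq power)
  qed
  have err: "norm (s z - u n z) \<le> norm (s z) * (1 - \<rho> z / 3) ^ n" if z: "z \<in> D" for z n
  proof (induction n)
    case 0 then show ?case by (simp add: u0)
  next
    case (Suc n)
    define e where "e = s z - u n z"
    have r: "0 \<le> \<rho> z" "\<rho> z \<le> 1" using \<rho> z by auto
    have s: "norm (s z) \<le> 11/10 * \<rho> z"
      using near[OF z] r norm_triangle_ineq[of "s z - of_real (\<rho> z)" "of_real (\<rho> z)"] by simp
    have "norm (s z) * (1 - \<rho> z / 3) ^ n \<le> norm (s z)"
      using r by (intro mult_right_le_one_le power_le_one) auto
    then have e: "norm e \<le> norm (s z)" using Suc by (simp add: e_def)
    have 1: "norm (1 - of_real (\<rho> z) :: complex) = 1 - \<rho> z"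
      using r by (metis abs_of_nonneg diff_ge_0_iff_ge norm_of_real of_real_1 of_real_diff)
    have "1 - s z + e / 2 = (1 - of_real (\<rho> z)) - (s z - of_real (\<rho> z)) + e / 2" by simp
    then have "norm (1 - s z + e / 2) \<le> (1 - \<rho> z) + norm (s z - of_real (\<rho> z)) + norm e / 2"
      using norm_triangle_ineq[of "(1 - of_real (\<rho> z)) - (s z - of_real (\<rho> z))" "e / 2"]
        norm_triangle_ineq4[of "1 - of_real (\<rho> z)" "s z - of_real (\<rho> z)"] 1
      by (simp add: norm_divide)
    \<comment> \<open>The induction hypothesis keeps the error below its initial value
      \<open>norm (s z)\<close>, at most 11/10 of \<open>\<rho> z\<close>. The sum is then at most
      \<open>1 - \<rho> z\<close> times (1 - 1/10 - 11/20), and 7/20 exceeds 1/3.\<close>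
    also have "\<dots> \<le> 1 - \<rho> z / 3" using e s near[OF z] r by linarith
    finally have f: "norm (1 - s z + e / 2) \<le> 1 - \<rho> z / 3" .
    have "s z - u (Suc n) z = e * (1 - s z + e / 2)"
      by (simp add: uS e_def field_simps power2_eq_square)
    then have "norm (s z - u (Suc n) z) = norm e * norm (1 - s z + e / 2)"
      by (simp add: norm_mult)
    also have "\<dots> \<le> (norm (s z) * (1 - \<rho> z / 3) ^ n) * (1 - \<rho> z / 3)"
      using Suc f r by (intro mult_mono) (auto simp: e_def)
    finally show ?case by (simp add: algebra_simps)
  qed
  \<comment> \<open>Bernoulli bounds \<open>1 + n * x\<close> by \<open>(1 + x) ^ n\<close>, and
    \<open>(1 - x) ^ n * (1 + x) ^ n\<close> is at most 1.\<close>
  have decay: "x * (1 - x) ^ n \<le> 1 / real n" if "0 \<le> x" "x \<le> 1" "n > 0" for x :: real and n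
  proof -
    have "(1 - x) ^ n * (1 + real n * x) \<le> (1 - x) ^ n * (1 + x) ^ n"
      using that by (intro mult_left_mono Bernoulli_inequality) auto
    also have "\<dots> = (1 - x\<^sup>2) ^ n"
      by (simp add: power_mult_distrib[symmetric] power2_eq_square algebra_simps)
    also have "\<dots> \<le> 1" using that by (intro power_le_one) (auto simp: power_le_one)
    finally have "(1 - x) ^ n + (1 - x) ^ n * (real n * x) \<le> 1"
      by (simp add: distrib_left)
    moreover have "0 \<le> (1 - x) ^ n" using that by simp
    ultimately have "(1 - x) ^ n * (real n * x) \<le> 1" by linarith
    then show ?thesis using that by (simp add: field_simps)
  qed
  show ?thesis
  proof (rule limit_seq[where p = "\<lambda>n. u (Suc n)" and e = "\<lambda>n. 33/10 * (1 / real (Suc n))"])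
    show "(\<lambda>n. 33/10 * (1 / real (Suc n))) \<longlonglongrightarrow> 0"
      using tendsto_mult_right_zero[OF LIMSEQ_inverse_real_of_nat, of "33/10"]
      by (simp add: inverse_eq_divide)
    fix n z assume z: "z \<in> D"
    have r: "0 \<le> \<rho> z" "\<rho> z \<le> 1" using \<rho> z by auto
    have s: "norm (s z) \<le> 33/10 * (\<rho> z / 3)"
      using near[OF z] r norm_triangle_ineq[of "s z - of_real (\<rho> z)" "of_real (\<rho> z)"] by simp
    have "norm (s z - u (Suc n) z) \<le> 33/10 * (\<rho> z / 3) * (1 - \<rho> z / 3) ^ Suc n"
      using r by (intro order_trans[OF err[OF z]] mult_right_mono[OF s]) auto
    also have "\<dots> \<le> 33/10 * (1 / real (Suc n))"
      using mult_left_mono[OF decay[of "\<rho> z / 3" "Suc n"], of "33/10"] r by (simp only: mult.assoc)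
    finally show "norm (s z - u (Suc n) z) \<le> 33/10 * (1 / real (Suc n))" .
  qed (rule uA)
qed

end

section \<open>The algebra generated by two functions\<close>

text \<open>One bound \<open>N\<close> serves both exponents, as in
  \<open>poly_algebra_dense\<close>; sums therefore need padding with zero coefficients to a common
  bound.\<close>

definition poly_functions :: "('a \<Rightarrow> complex) \<Rightarrow> ('a \<Rightarrow> complex) \<Rightarrow> ('a \<Rightarrow> complex) set" where
  "poly_functions f1 f2 = {p. \<exists>N c. p = (\<lambda>z. \<Sum>i\<le>N. \<Sum>j\<le>N. c i j * f1 z ^ i * f2 z ^ j)}"

lemma poly_functionsI:
  "(\<And>z. p z = (\<Sum>i\<le>N. \<Sum>j\<le>N. c i j * f1 z ^ i * f2 z ^ j)) \<Longrightarrow> p \<in> poly_functions f1 f2"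
  unfolding poly_functions_def by blast

lemma poly_functions_monomial:
  "(\<lambda>z. c * f1 z ^ i * f2 z ^ j) \<in> poly_functions f1 f2"
proof (rule poly_functionsI)
  fix z
  have inner: "(\<Sum>l\<le>i+j. (if k = i \<and> l = j then c else 0) * f1 z ^ k * f2 z ^ l) =
        (if k = i then c * f1 z ^ i * f2 z ^ j else 0)" for k
  proof -
    have "(\<Sum>l\<le>i+j. (if k = i \<and> l = j then c else 0) * f1 z ^ k * f2 z ^ l) =
          (\<Sum>l\<le>i+j. if l = j then (if k = i then c * f1 z ^ i * f2 z ^ j else 0) else 0)"
      by (intro sum.cong refl) auto
    then show ?thesis by simp
  qed
  have "(\<Sum>k\<le>i+j. \<Sum>l\<le>i+j. (if k = i \<and> l = j then c else 0) * f1 z ^ k * f2 z ^ l) =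
        c * f1 z ^ i * f2 z ^ j"
    unfolding inner by simp
  then show "c * f1 z ^ i * f2 z ^ j =
     (\<Sum>k\<le>i+j. \<Sum>l\<le>i+j. (if k = i \<and> l = j then c else 0) * f1 z ^ k * f2 z ^ l)" ..
qed

lemma poly_functions_extend:
  fixes c :: "nat \<Rightarrow> nat \<Rightarrow> complex"
  assumes "N \<le> M"
  shows "(\<Sum>i\<le>N. \<Sum>j\<le>N. c i j * x ^ i * y ^ j) =
         (\<Sum>i\<le>M. \<Sum>j\<le>M. (if i \<le> N \<and> j \<le> N then c i j else 0) * x ^ i * y ^ j)"
proof -
  have "(\<Sum>i\<le>M. \<Sum>j\<le>M. (if i \<le> N \<and> j \<le> N then c i j else 0) * x ^ i * y ^ j) =
        (\<Sum>i\<le>N. \<Sum>j\<le>M. (if i \<le> N \<and> j \<le> N then c i j else 0) * x ^ i * y ^ j)"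
    using assms by (intro sum.mono_neutral_right) auto
  also have "\<dots> = (\<Sum>i\<le>N. \<Sum>j\<le>N. (if i \<le> N \<and> j \<le> N then c i j else 0) * x ^ i * y ^ j)"
    using assms by (intro sum.cong sum.mono_neutral_right) auto
  also have "\<dots> = (\<Sum>i\<le>N. \<Sum>j\<le>N. c i j * x ^ i * y ^ j)"
    by (intro sum.cong) auto
  finally show ?thesis by simp
qed

lemma poly_functions_add:
  assumes "p \<in> poly_functions f1 f2" "q \<in> poly_functions f1 f2"
  shows "(\<lambda>z. p z + q z) \<in> poly_functions f1 f2"
proof -
  obtain N c where p: "p = (\<lambda>z. \<Sum>i\<le>N. \<Sum>j\<le>N. c i j * f1 z ^ i * f2 z ^ j)"
    using assms(1) unfolding poly_functions_def by blast
  obtain M d where q: "q = (\<lambda>z. \<Sum>i\<le>M. \<Sum>j\<le>M. d i j * f1 z ^ i * f2 z ^ j)"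
    using assms(2) unfolding poly_functions_def by blast
  define c' where "c' i j = (if i \<le> N \<and> j \<le> N then c i j else 0)" for i j
  define d' where "d' i j = (if i \<le> M \<and> j \<le> M then d i j else 0)" for i j
  show ?thesis
  proof (rule poly_functionsI)
    fix z
    have "p z = (\<Sum>i\<le>max N M. \<Sum>j\<le>max N M. c' i j * f1 z ^ i * f2 z ^ j)"
      unfolding p c'_def by (rule poly_functions_extend) simp
    moreover have "q z = (\<Sum>i\<le>max N M. \<Sum>j\<le>max N M. d' i j * f1 z ^ i * f2 z ^ j)"
      unfolding q d'_def by (rule poly_functions_extend) simp
    ultimately show "p z + q z =
        (\<Sum>i\<le>max N M. \<Sum>j\<le>max N M. (\<lambda>i j. c' i j + d' i j) i j * f1 z ^ i * f2 z ^ j)"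
      by (simp add: sum.distrib[symmetric] distrib_right)
  qed
qed

lemma poly_functions_sum:
  "(\<And>i. i \<in> I \<Longrightarrow> f i \<in> poly_functions f1 f2) \<Longrightarrow> (\<lambda>z. \<Sum>i\<in>I. f i z) \<in> poly_functions f1 f2"
proof (induction I rule: infinite_finite_induct)
  case (infinite A) then show ?case using poly_functions_monomial[of 0 f1 0 f2 0] by simp
next
  case empty then show ?case using poly_functions_monomial[of 0 f1 0 f2 0] by simp
next
  case (insert x I) then show ?case by (auto intro: poly_functions_add)
qed

lemma poly_functions_mult:
  assumes "p \<in> poly_functions f1 f2" "q \<in> poly_functions f1 f2"
  shows "(\<lambda>z. p z * q z) \<in> poly_functions f1 f2"
proof -
  obtain N c where p: "p = (\<lambda>z. \<Sum>i\<le>N. \<Sum>j\<le>N. c i j * f1 z ^ i * f2 z ^ j)"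
    using assms(1) unfolding poly_functions_def by blast
  obtain M d where q: "q = (\<lambda>z. \<Sum>k\<le>M. \<Sum>l\<le>M. d k l * f1 z ^ k * f2 z ^ l)"
    using assms(2) unfolding poly_functions_def by blast
  have monomial: "(\<lambda>z. a * f1 z ^ i * f2 z ^ j * q z) \<in> poly_functions f1 f2" for a i j
  proof -
    have "(\<lambda>z. a * f1 z ^ i * f2 z ^ j * q z) =
          (\<lambda>z. \<Sum>k\<le>M. \<Sum>l\<le>M. (a * d k l) * f1 z ^ (i + k) * f2 z ^ (j + l))"
      unfolding q by (simp add: sum_distrib_left power_add ac_simps)
    then show ?thesis
      by (simp only:) (intro poly_functions_sum poly_functions_monomial)
  qed
  have "(\<lambda>z. p z * q z) = (\<lambda>z. \<Sum>i\<le>N. \<Sum>j\<le>N. c i j * f1 z ^ i * f2 z ^ j * q z)"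
    unfolding p by (simp add: sum_distrib_right)
  then show ?thesis
    by (simp only:) (intro poly_functions_sum monomial)
qed

section \<open>Closure of the polynomials in two functions, and its link with density\<close>

definition generated_algebra_on ::
    "'a set \<Rightarrow> ('a \<Rightarrow> complex) \<Rightarrow> ('a \<Rightarrow> complex) \<Rightarrow> ('a \<Rightarrow> complex) set" where
  "generated_algebra_on D f1 f2 = uniform_closure_on D (poly_functions f1 f2)"

lemma bounded_functions_on_sum:
  "(\<And>i. i \<in> I \<Longrightarrow> f i \<in> bounded_functions_on D) \<Longrightarrow> (\<lambda>z. \<Sum>i\<in>I. f i z) \<in> bounded_functions_on D"
  by (induction I rule: infinite_finite_induct)
    (auto intro: bounded_functions_onI[where M = 0] bounded_functions_on_add)

lemma bounded_functions_on_power: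
  "f \<in> bounded_functions_on D \<Longrightarrow> (\<lambda>z. f z ^ n) \<in> bounded_functions_on D"
  by (induction n) (auto intro: bounded_functions_onI[where M = 1] bounded_functions_on_mult)

lemma poly_functions_bounded:
  assumes "f1 \<in> bounded_functions_on D" "f2 \<in> bounded_functions_on D"
  shows "poly_functions f1 f2 \<subseteq> bounded_functions_on D"
proof -
  have "(\<lambda>z. c) \<in> bounded_functions_on D" for c
    by (rule bounded_functions_onI[where M = "norm c"]) simp
  then show ?thesis
    using assms unfolding poly_functions_def
    by (auto intro!: bounded_functions_on_sum bounded_functions_on_mult bounded_functions_on_power)
qed

lemma uniform_algebra_on_generated:
  assumes "f1 \<in> bounded_functions_on D" "f2 \<in> bounded_functions_on D"
  shows "uniform_algebra_on D (generated_algebra_on D f1 f2)"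
  unfolding generated_algebra_on_def
proof
  show "(\<lambda>_. c) \<in> uniform_closure_on D (poly_functions f1 f2)" for c
    using poly_functions_monomial[of c f1 0 f2 0] subset_uniform_closure_on by fastforce
  note b = poly_functions_bounded[OF assms]
  show "(\<lambda>z. f z + g z) \<in> uniform_closure_on D (poly_functions f1 f2)"
    if "f \<in> uniform_closure_on D (poly_functions f1 f2)" "g \<in> uniform_closure_on D (poly_functions f1 f2)" for f g
    using poly_functions_add that by (rule uniform_closure_on_add)
  show "(\<lambda>z. f z * g z) \<in> uniform_closure_on D (poly_functions f1 f2)"
    if "f \<in> uniform_closure_on D (poly_functions f1 f2)" "g \<in> uniform_closure_on D (poly_functions f1 f2)" for f g
    using poly_functions_mult that b b by (rule uniform_closure_on_mult)
  show "uniform_closure_on D (poly_functions f1 f2) \<subseteq> bounded_functions_on D"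
    by (rule uniform_closure_on_bounded[OF b])
qed (simp add: uniform_closure_on_idem)

lemma generators_in_generated_algebra_on:
  "f1 \<in> generated_algebra_on D f1 f2" "f2 \<in> generated_algebra_on D f1 f2"
  using poly_functions_monomial[of 1 f1 1 f2 0] poly_functions_monomial[of 1 f1 0 f2 1]
    subset_uniform_closure_on[of "poly_functions f1 f2" D]
  by (auto simp: generated_algebra_on_def)

lemma (in uniform_algebra_on) generated_algebra_on_subset:
  assumes "f1 \<in> A" "f2 \<in> A"
  shows "generated_algebra_on D f1 f2 \<subseteq> A"
proof -
  have "poly_functions f1 f2 \<subseteq> A"
    using assms unfolding poly_functions_def by (auto intro!: sum mult power const)
  then show ?thesis
    using uniform_closure_on_mono[of _ A D] closed unfolding generated_algebra_on_def by blast
qed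

text \<open>Density depends on the generators only through their closed algebra, so the theorem
  reduces to an equality of two algebras.\<close>

lemma poly_algebra_dense_iff:
  "poly_algebra_dense f1 f2 D \<longleftrightarrow> (\<forall>h. continuous_on D h \<longrightarrow> h \<in> generated_algebra_on D f1 f2)"
proof -
  have "(\<exists>p\<in>poly_functions f1 f2. Q p) \<longleftrightarrow>
        (\<exists>N c. Q (\<lambda>z. \<Sum>i\<le>N. \<Sum>j\<le>N. c i j * f1 z ^ i * f2 z ^ j))" for Q
    unfolding poly_functions_def by blast
  then show ?thesis
    unfolding poly_algebra_dense_def generated_algebra_on_def uniform_closure_on_def by simp
qed

section \<open>Even and odd functions\<close>

text \<open>Parity is formal here: \<open>A\<close> plays the even part and \<open>B\<close> the odd
  part under multiplication, but members of \<open>B\<close> need not be odd as functions, and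
  \<open>A\<close> and \<open>B\<close> may overlap. This is how \<open>g\<close>, which need not be
  odd, can count as odd.\<close>

locale parity_algebra_on = uniform_algebra_on D A
  for D :: "'a set" and A :: "('a \<Rightarrow> complex) set" +
  fixes B :: "('a \<Rightarrow> complex) set"
  assumes odd_add: "f \<in> B \<Longrightarrow> g \<in> B \<Longrightarrow> (\<lambda>z. f z + g z) \<in> B"
    and even_odd: "f \<in> A \<Longrightarrow> g \<in> B \<Longrightarrow> (\<lambda>z. f z * g z) \<in> B"
    and odd_odd: "f \<in> B \<Longrightarrow> g \<in> B \<Longrightarrow> (\<lambda>z. f z * g z) \<in> A"
    and odd_closed: "uniform_closure_on D B \<subseteq> B"
begin

lemma odd_cmult: "f \<in> B \<Longrightarrow> (\<lambda>z. c * f z) \<in> B"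
  using even_odd[OF const] .

lemma odd_diff: "f \<in> B \<Longrightarrow> g \<in> B \<Longrightarrow> (\<lambda>z. f z - g z) \<in> B"
  using odd_add[OF _ odd_cmult[of g "-1"]] by simp

lemma odd_sum:
  assumes "(\<lambda>_. 0) \<in> B"
  shows "(\<And>i. i \<in> I \<Longrightarrow> f i \<in> B) \<Longrightarrow> (\<lambda>z. \<Sum>i\<in>I. f i z) \<in> B"
  by (induction I rule: infinite_finite_induct) (auto intro: assms odd_add)

lemma odd_power:
  assumes "u \<in> B"
  shows "(\<lambda>z. u z ^ n) \<in> (if even n then A else B)"
proof (induction n)
  case 0 then show ?case by (simp add: const)
next
  case (Suc n)
  then show ?case
    using odd_odd[OF assms, of "\<lambda>z. u z ^ n"] even_odd[of "\<lambda>z. u z ^ n", OF _ assms]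
    by (auto simp: mult.commute split: if_splits)
qed

lemma odd_monomial:
  assumes "u \<in> B" "v \<in> B" "odd (i + j)"
  shows "(\<lambda>z. u z ^ i * v z ^ j) \<in> B"
proof (cases "even i")
  case True
  then show ?thesis
    using odd_power[OF assms(1), of i] odd_power[OF assms(2), of j] assms(3) by (auto intro: even_odd)
next
  case False
  then show ?thesis
    using odd_power[OF assms(1), of i] odd_power[OF assms(2), of j] assms(3)
      even_odd[of "\<lambda>z. v z ^ j" "\<lambda>z. u z ^ i"] by (auto simp: mult.commute)
qed

text \<open>A polynomial approximating \<open>F\<close> need not be odd. Its odd part approximates
  \<open>F\<close> equally well, because \<open>F\<close> is odd and the bidisc is symmetric; and
  the odd part involves only monomials of odd total degree, which send \<open>B\<close> to
  \<open>B\<close>.\<close>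

lemma odd_compose:
  assumes F: "F \<in> generated_algebra_on (cball 0 \<delta> \<times> cball 0 \<delta>) fst snd"
    and odd: "\<And>p. p \<in> cball 0 \<delta> \<times> cball 0 \<delta> \<Longrightarrow> F (- p) = - F p"
    and uv: "u \<in> B" "v \<in> B"
    and u: "\<And>z. z \<in> D \<Longrightarrow> norm (u z) \<le> \<delta>" and v: "\<And>z. z \<in> D \<Longrightarrow> norm (v z) \<le> \<delta>"
  shows "(\<lambda>z. F (u z, v z)) \<in> B"
proof -
  have zero: "(\<lambda>_. 0) \<in> B" using odd_cmult[OF uv(1), of 0] by simp
  have "(\<lambda>z. F (u z, v z)) \<in> uniform_closure_on D B"
  proof (rule uniform_closure_onI)
    fix \<epsilon> :: real assume "\<epsilon> > 0"
    then obtain q where "q \<in> poly_functions fst snd"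
        and q: "\<And>p. p \<in> cball 0 \<delta> \<times> cball 0 \<delta> \<Longrightarrow> norm (F p - q p) < \<epsilon>"
      using F unfolding generated_algebra_on_def by (auto elim: uniform_closure_onE)
    then obtain N c where qc: "q = (\<lambda>p. \<Sum>i\<le>N. \<Sum>j\<le>N. c i j * fst p ^ i * snd p ^ j)"
      unfolding poly_functions_def by blast
    define w where
      "w z = (\<Sum>i\<le>N. \<Sum>j\<le>N. (if odd (i + j) then c i j else 0) * (u z ^ i * v z ^ j))" for z
    have "(\<lambda>z. (if odd (i + j) then c i j else 0) * (u z ^ i * v z ^ j)) \<in> B" for i j
      using odd_cmult[OF odd_monomial[OF uv]] zero by auto
    then have "w \<in> B" unfolding w_def by (intro odd_sum zero)
    moreover have "norm (F (u z, v z) - w z) < \<epsilon>" if "z \<in> D" for z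
    proof -
      define p where "p = (u z, v z)"
      have p: "p \<in> cball 0 \<delta> \<times> cball 0 \<delta>" "- p \<in> cball 0 \<delta> \<times> cball 0 \<delta>"
        using u[OF that] v[OF that] by (auto simp: p_def)
      \<comment> \<open>Monomials of even total degree cancel and those of odd total degree double,
        so \<open>w\<close> is the odd part of \<open>q\<close> at
        \<open>(u z, v z)\<close>.\<close>
      have "2 * w z = q p - q (- p)"
        unfolding w_def qc p_def sum_distrib_left sum_subtractf[symmetric]
        by (intro sum.cong refl) (auto simp: power_minus[of "u z"] power_minus[of "v z"] algebra_simps
              power_add[symmetric] minus_one_power_iff)
      then have "2 * (F p - w z) = (F p - q p) - (F (- p) - q (- p))"
        using odd[OF p(1)] by (simp add: algebra_simps)
      then have "2 * norm (F p - w z) \<le> norm (F p - q p) + norm (F (- p) - q (- p))"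
        by (metis norm_mult norm_numeral norm_triangle_ineq4)
      then show ?thesis using q[OF p(1)] q[OF p(2)] by (simp add: p_def)
    qed
    ultimately show "\<exists>p\<in>B. \<forall>z\<in>D. norm (F (u z, v z) - p z) < \<epsilon>" by blast
  qed
  then show ?thesis using odd_closed by blast
qed

end

text \<open>\<open>B\<close> is the closure of the \<open>A\<close>-module \<open>V\<close> spanned
  by \<open>f1\<close> and \<open>f2\<close>. A product of two elements of \<open>V\<close> combines
  \<open>f1^2\<close>, \<open>f1 * f2\<close> and \<open>f2^2\<close> with coefficients in
  \<open>A\<close>, so these three memberships suffice.\<close>

lemma (in uniform_algebra_on) obtain_parity_algebra_on:
  assumes f: "f1 \<in> bounded_functions_on D" "f2 \<in> bounded_functions_on D"
    and products: "(\<lambda>z. f1 z ^ 2) \<in> A" "(\<lambda>z. f1 z * f2 z) \<in> A" "(\<lambda>z. f2 z ^ 2) \<in> A"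
  obtains B where "parity_algebra_on D A B" "f1 \<in> B" "f2 \<in> B"
proof -
  define V where "V = {\<lambda>z. f1 z * a z + f2 z * b z | a b. a \<in> A \<and> b \<in> A}"
  define B where "B = uniform_closure_on D V"
  have V: "(\<lambda>z. f1 z * a z + f2 z * b z) \<in> V" if "a \<in> A" "b \<in> A" for a b
    using that unfolding V_def by blast
  have V_bounded: "V \<subseteq> bounded_functions_on D"
    unfolding V_def using bounded f
    by (auto intro!: bounded_functions_on_add bounded_functions_on_mult)
  \<comment> \<open>Lets elements of \<open>A\<close> enter, and products leave,
    \<open>uniform_closure_on_mult\<close> as uniform limits.\<close>
  have A_closure: "uniform_closure_on D A = A"
    using closed subset_uniform_closure_on[of A D] by blast
  have V_add: "(\<lambda>z. p z + q z) \<in> V" if pq: "p \<in> V" "q \<in> V" for p q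
  proof -
    obtain a b c d where "a \<in> A" "b \<in> A" "c \<in> A" "d \<in> A"
      "p = (\<lambda>z. f1 z * a z + f2 z * b z)" "q = (\<lambda>z. f1 z * c z + f2 z * d z)"
      using pq unfolding V_def by blast
    then show ?thesis
      using V[OF add[of a c] add[of b d]] by (simp add: algebra_simps)
  qed
  have A_V: "(\<lambda>z. p z * q z) \<in> V" if pq: "p \<in> A" "q \<in> V" for p q
  proof -
    obtain a b where "a \<in> A" "b \<in> A" "q = (\<lambda>z. f1 z * a z + f2 z * b z)"
      using pq unfolding V_def by blast
    then show ?thesis
      using V[OF mult[of p a] mult[of p b]] that by (simp add: algebra_simps)
  qed
  have V_V: "(\<lambda>z. p z * q z) \<in> A" if pq: "p \<in> V" "q \<in> V" for p q
  proof -
    obtain a b c d where abcd: "a \<in> A" "b \<in> A" "c \<in> A" "d \<in> A"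
      and pq_eq: "p = (\<lambda>z. f1 z * a z + f2 z * b z)" "q = (\<lambda>z. f1 z * c z + f2 z * d z)"
      using pq unfolding V_def by blast
    have "(\<lambda>z. p z * q z) = (\<lambda>z. f1 z ^ 2 * (a z * c z)
            + (f1 z * f2 z) * (a z * d z + b z * c z) + f2 z ^ 2 * (b z * d z))"
      by (simp add: pq_eq algebra_simps power2_eq_square)
    moreover have "\<dots> \<in> A"
      using abcd by (intro add mult products)
    ultimately show ?thesis by simp
  qed
  have "parity_algebra_on D A B"
  proof
    show "(\<lambda>z. f z + g z) \<in> B" if "f \<in> B" "g \<in> B" for f g
      using V_add that unfolding B_def by (rule uniform_closure_on_add)
    show "(\<lambda>z. f z * g z) \<in> B" if "f \<in> A" "g \<in> B" for f g
    proof -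
      have "f \<in> uniform_closure_on D A" using that(1) A_closure by simp
      with A_V show ?thesis
        using that(2) bounded V_bounded unfolding B_def by (rule uniform_closure_on_mult)
    qed
    show "(\<lambda>z. f z * g z) \<in> A" if "f \<in> B" "g \<in> B" for f g
    proof -
      have "(\<lambda>z. f z * g z) \<in> uniform_closure_on D A"
        using V_V that V_bounded V_bounded unfolding B_def by (rule uniform_closure_on_mult)
      then show ?thesis using A_closure by simp
    qed
    show "uniform_closure_on D B \<subseteq> B"
      unfolding B_def by (simp add: uniform_closure_on_idem)
  qed
  moreover have "f1 \<in> B" "f2 \<in> B"
    using V[OF const const, of 1 0] V[OF const const, of 0 1] subset_uniform_closure_on[of V D]
    unfolding B_def by auto
  ultimately show thesis using that by blast
qed

section \<open>Polynomial approximation of holomorphic functions of two variables\<close>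

text \<open>Cauchy's estimates bound the i-th coefficient by \<open>M / R ^ i\<close>, so the tail
  is dominated by a geometric series of ratio at most 1/2, whence the factor 2. The exact power of
  \<open>norm w / R\<close> is kept because the remainder is later divided by a power of the
  variable.\<close>

lemma taylor_remainder_bound:
  assumes G: "G holomorphic_on ball 0 R'" and R: "0 < R" "R < R'"
    and M: "\<And>w. norm w \<le> R \<Longrightarrow> norm (G w) \<le> M"
    and w: "norm w \<le> R / 2"
  shows "norm (G w - (\<Sum>i<n. (deriv ^^ i) G 0 / fact i * w ^ i)) \<le> 2 * M * (norm w / R) ^ n"
proof -
  define a where "a i = (deriv ^^ i) G 0 / fact i" for i
  define x where "x = norm w / R"
  have x: "0 \<le> x" "x \<le> 1/2" using R w by (auto simp: x_def field_simps)
  have M0: "0 \<le> M" using M[of 0] R norm_ge_zero[of "G 0"] by (simp del: norm_ge_zero)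
  have a: "norm (a i * w ^ i) \<le> M * x ^ i" for i
  proof -
    have "norm ((deriv ^^ i) G 0) \<le> fact i * M / R ^ i"
    proof (rule Cauchy_inequality)
      show "G holomorphic_on ball 0 R" using G R by (auto intro: holomorphic_on_subset)
      have "cball 0 R \<subseteq> ball 0 R'" using R by auto
      then show "continuous_on (cball 0 R) G"
        using G by (meson continuous_on_subset holomorphic_on_imp_continuous_on)
    qed (use R M in auto)
    then have "norm (a i) \<le> M / R ^ i" by (simp add: a_def norm_divide field_simps)
    then have "norm (a i) * norm w ^ i \<le> M / R ^ i * norm w ^ i" by (rule mult_right_mono) simp
    then show ?thesis by (simp add: norm_mult norm_power x_def power_divide)
  qed
  have "(\<lambda>i. a i * w ^ i) sums G w"
    using holomorphic_power_series[OF G, of w] R w by (simp add: a_def)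
  then have "(\<lambda>i. a (i + n) * w ^ (i + n)) sums (G w - (\<Sum>i<n. a i * w ^ i))"
    by (rule sums_split_initial_segment)
  moreover have "(\<lambda>i. M * x ^ n * x ^ i) sums (M * x ^ n * (1 / (1 - x)))"
    using x by (intro sums_mult geometric_sums) auto
  moreover have "norm (a (i + n) * w ^ (i + n)) \<le> M * x ^ n * x ^ i" for i
    using a[of "i + n"] by (simp only: power_add mult.assoc mult.commute[of "x ^ n"])
  ultimately have "norm (G w - (\<Sum>i<n. a i * w ^ i)) \<le> M * x ^ n * (1 / (1 - x))"
    by (rule norm_sums_le)
  also have "\<dots> \<le> M * x ^ n * 2"
    using x M0 by (intro mult_left_mono) (auto simp: field_simps)
  finally show ?thesis by (simp add: a_def x_def algebra_simps)
qed

text \<open>The Taylor coefficients \<open>a\<^sub>j(w\<^sub>1)\<close> of \<open>F(w\<^sub>1, \<cdot>)\<close> are, inductively, uniform limits of polynomials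
  in \<open>w\<^sub>1\<close>: the quotient \<open>(F(w\<^sub>1, t) - \<Sum>\<^sub>i\<^sub><\<^sub>j a\<^sub>i(w\<^sub>1) t\<^sup>i) / t\<^sup>j\<close> tends to \<open>a\<^sub>j(w\<^sub>1)\<close>
  uniformly as \<open>t\<close> tends to \<open>0\<close>.\<close>

lemma separately_holomorphic_in_generated_algebra_on:
  fixes F :: "complex \<times> complex \<Rightarrow> complex"
  assumes h1: "\<And>w2. norm w2 \<le> R \<Longrightarrow> (\<lambda>w1. F (w1, w2)) holomorphic_on ball 0 R'"
    and h2: "\<And>w1. norm w1 \<le> R \<Longrightarrow> (\<lambda>w2. F (w1, w2)) holomorphic_on ball 0 R'"
    and R: "0 < R" "R < R'"
    and M: "\<And>w1 w2. norm w1 \<le> R \<Longrightarrow> norm w2 \<le> R \<Longrightarrow> norm (F (w1, w2)) \<le> M"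
  shows "F \<in> generated_algebra_on (cball 0 (R/2) \<times> cball 0 (R/2)) fst snd"
proof -
  define P :: "(complex \<times> complex) set" where "P = cball 0 (R/2) \<times> cball 0 (R/2)"
  define A where "A = generated_algebra_on P fst snd"
  have "fst \<in> bounded_functions_on P" "snd \<in> bounded_functions_on P"
    by (auto intro!: bounded_functions_onI[where M = "R/2"] simp: P_def)
  then interpret uniform_algebra_on P A
    unfolding A_def by (rule uniform_algebra_on_generated)
  have gen: "fst \<in> A" "snd \<in> A" unfolding A_def by (rule generators_in_generated_algebra_on)+
  have M0: "0 \<le> M" using M[of 0 0] R norm_ge_zero[of "F (0, 0)"] by (simp del: norm_ge_zero)
  have geo: "(\<lambda>n. 2 * M * (1/2) ^ n) \<longlonglongrightarrow> 0"
    by (intro tendsto_mult_right_zero LIMSEQ_power_zero) simp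
  have half: "2 * M * (norm w / R) ^ n \<le> 2 * M * (1/2) ^ n" if "norm w \<le> R/2" for w :: complex and n
    using that R M0 by (intro mult_left_mono power_mono) (auto simp: field_simps)
  \<comment> \<open>With the second variable frozen, Taylor polynomials in the first converge
    uniformly; these slices supply the quotients that recover the coefficients
    \<open>a j\<close>.\<close>
  have slice: "(\<lambda>p. F (fst p, w2)) \<in> A" if w2: "norm w2 \<le> R" for w2
  proof (rule limit_seq[OF _ geo])
    show "(\<lambda>p. \<Sum>i<n. (deriv ^^ i) (\<lambda>w1. F (w1, w2)) 0 / fact i * fst p ^ i) \<in> A" for n
      by (intro sum cmult power gen)
    show "norm (F (fst p, w2) - (\<Sum>i<n. (deriv ^^ i) (\<lambda>w1. F (w1, w2)) 0 / fact i * fst p ^ i))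
        \<le> 2 * M * (1/2) ^ n" if "p \<in> P" for p n
      using taylor_remainder_bound[OF h1[OF w2] R M[OF _ w2], of "fst p" n] that half[of "fst p" n]
      by (auto simp: P_def)
  qed
  define a where "a j w1 = (deriv ^^ j) (\<lambda>w2. F (w1, w2)) 0 / fact j" for j w1
  have tail: "norm (F (w1, w2) - (\<Sum>i<n. a i w1 * w2 ^ i)) \<le> 2 * M * (norm w2 / R) ^ n"
    if "norm w1 \<le> R" "norm w2 \<le> R/2" for w1 w2 n
    unfolding a_def by (rule taylor_remainder_bound[OF h2[OF that(1)] R M[OF that(1)] that(2)])
  have coeff: "(\<lambda>p. a j (fst p)) \<in> A" for j
  proof (induction j rule: less_induct)
    case (less j)
    define t where "t n = R / 2 * inverse (real (Suc n))" for n
    have t: "0 < t n" "t n \<le> R/2" for n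
      using R by (auto simp: t_def field_simps)
    \<comment> \<open>The remainder of order \<open>Suc j\<close> at \<open>t n\<close>, divided by
      \<open>t n ^ j\<close>, leaves one factor \<open>t n\<close>, which tends to 0.\<close>
    define e where "e n = 2 * M / R ^ Suc j * t n" for n
    have "t \<longlonglongrightarrow> 0"
      unfolding t_def by (intro tendsto_mult_right_zero LIMSEQ_inverse_real_of_nat)
    then have e: "e \<longlonglongrightarrow> 0" unfolding e_def by (rule tendsto_mult_right_zero)
    show ?case
    proof (rule limit_seq[OF _ e])
      fix n
      show "(\<lambda>p. 1 / of_real (t n) ^ j *
          (F (fst p, of_real (t n)) - (\<Sum>i<j. of_real (t n) ^ i * a i (fst p)))) \<in> A"
        using t[of n] R less by (intro cmult diff slice sum) auto
      fix p assume "p \<in> P"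
      then have p: "norm (fst p) \<le> R" using R by (auto simp: P_def)
      define T :: complex where "T = of_real (t n)"
      have T: "norm T = t n" "T \<noteq> 0" using t[of n] by (auto simp: T_def)
      have "a j (fst p) - 1 / T ^ j * (F (fst p, T) - (\<Sum>i<j. T ^ i * a i (fst p))) =
            - (F (fst p, T) - (\<Sum>i<Suc j. a i (fst p) * T ^ i)) / T ^ j"
        using T(2) by (simp add: field_simps)
      then have "norm (a j (fst p) - 1 / T ^ j * (F (fst p, T) - (\<Sum>i<j. T ^ i * a i (fst p)))) =
            norm (F (fst p, T) - (\<Sum>i<Suc j. a i (fst p) * T ^ i)) / t n ^ j"
        by (simp only: norm_divide norm_minus_cancel norm_power T)
      also have "\<dots> \<le> 2 * M * (norm T / R) ^ Suc j / t n ^ j"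
        using t[of n] T by (intro divide_right_mono tail p) auto
      also have "\<dots> = e n"
        using t[of n] R by (simp add: T e_def field_simps)
      finally show "norm (a j (fst p) - 1 / of_real (t n) ^ j *
          (F (fst p, of_real (t n)) - (\<Sum>i<j. of_real (t n) ^ i * a i (fst p)))) \<le> e n"
        by (simp add: T_def)
    qed
  qed
  have "F \<in> A"
  proof (rule limit_seq[OF _ geo])
    show "(\<lambda>p. \<Sum>i<n. a i (fst p) * snd p ^ i) \<in> A" for n
      by (intro sum mult power gen coeff)
    show "norm (F p - (\<Sum>i<n. a i (fst p) * snd p ^ i)) \<le> 2 * M * (1/2) ^ n" if "p \<in> P" for p n
      using tail[of "fst p" "snd p" n] half[of "snd p" n] that R by (auto simp: P_def)
  qed
  then show ?thesis by (simp add: A_def P_def)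
qed

text \<open>Discs of radius \<open>R/2\<close> about points of \<open>cball 0 (R/2)\<close> stay
  inside \<open>cball 0 R\<close>, so Cauchy's inequality bounds the derivative by
  \<open>2 * M / R\<close>; convexity turns this into a Lipschitz bound.\<close>

lemma holomorphic_lipschitz:
  assumes G: "G holomorphic_on ball 0 R'" and R: "0 < R" "R < R'"
    and M: "\<And>w. norm w \<le> R \<Longrightarrow> norm (G w) \<le> M"
    and uv: "norm u \<le> R / 2" "norm v \<le> R / 2"
  shows "norm (G u - G v) \<le> 2 * M / R * norm (u - v)"
proof (rule field_differentiable_bound[where S = "cball 0 (R/2)" and f' = "deriv G"])
  fix x :: complex assume x: "x \<in> cball 0 (R/2)"
  then show "(G has_field_derivative deriv G x) (at x within cball 0 (R/2))"
    using R by (intro has_field_derivative_at_within[OF holomorphic_derivI[OF G]]) auto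
  have sub: "norm y \<le> R" if "norm (x - y) \<le> R/2" for y
    using x that norm_triangle_ineq[of x "y - x"] by (simp add: norm_minus_commute)
  have "norm ((deriv ^^ 1) G x) \<le> fact 1 * M / (R/2) ^ 1"
  proof (rule Cauchy_inequality)
    have *: "cball x (R/2) \<subseteq> ball 0 R'" using sub R by (force simp: dist_norm)
    then show "G holomorphic_on ball x (R/2)"
      using G by (meson ball_subset_cball holomorphic_on_subset subset_trans)
    show "continuous_on (cball x (R/2)) G"
      using * G by (meson continuous_on_subset holomorphic_on_imp_continuous_on)
  qed (use R M sub in auto)
  then show "norm (deriv G x) \<le> 2 * M / R" by (simp add: field_simps)
qed (use uv in auto)

section \<open>Odd perturbations on a small disc\<close>

text \<open>Among the three products needed for a parity structure only \<open>z * k z\<close> is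
  not a generator. It differs from \<open>norm z ^ 2\<close> by \<open>z * (k z - cnj z)\<close>, so
  \<open>sqrt_closed\<close> applies with \<open>norm z ^ 2\<close> as \<open>\<rho>\<close>;
  \<open>r \<le> 1\<close> keeps this at most 1.\<close>

lemma obtain_parity_algebra_on_disc:
  assumes r: "r \<le> 1" and k: "k \<in> bounded_functions_on (cball 0 r)"
    and near: "\<And>z. norm z \<le> r \<Longrightarrow> norm (k z - cnj z) \<le> norm z / 10"
  obtains B where
    "parity_algebra_on (cball 0 r) (generated_algebra_on (cball 0 r) (\<lambda>z. z ^ 2) (\<lambda>z. k z ^ 2)) B"
    "(\<lambda>z. z) \<in> B" "k \<in> B"
proof -
  have id: "(\<lambda>z. z) \<in> bounded_functions_on (cball 0 r)"
    by (rule bounded_functions_onI[where M = r]) auto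
  interpret uniform_algebra_on "cball 0 r" "generated_algebra_on (cball 0 r) (\<lambda>z. z ^ 2) (\<lambda>z. k z ^ 2)"
    by (intro uniform_algebra_on_generated bounded_functions_on_power id k)
  note gen = generators_in_generated_algebra_on[where D = "cball 0 r" and ?f1.0 = "\<lambda>z. z ^ 2"
      and ?f2.0 = "\<lambda>z. k z ^ 2"]
  have "(\<lambda>z. z * k z) \<in> generated_algebra_on (cball 0 r) (\<lambda>z. z ^ 2) (\<lambda>z. k z ^ 2)"
  proof (rule sqrt_closed[where \<rho> = "\<lambda>z. norm z ^ 2"])
    show "(\<lambda>z. (z * k z) ^ 2) \<in> generated_algebra_on (cball 0 r) (\<lambda>z. z ^ 2) (\<lambda>z. k z ^ 2)"
      unfolding power_mult_distrib by (intro mult gen)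
    fix z :: complex assume z: "z \<in> cball 0 r"
    show "norm z ^ 2 \<le> 1" using z r by (intro power_le_one) auto
    have "z * k z - of_real (norm z ^ 2) = z * (k z - cnj z)"
      by (simp only: right_diff_distrib complex_norm_square)
    then show "norm (z * k z - of_real (norm z ^ 2)) \<le> norm z ^ 2 / 10"
      using mult_left_mono[OF near[of z], of "norm z"] z
      by (simp add: norm_mult power2_eq_square)
  qed auto
  then show thesis
    using obtain_parity_algebra_on[OF id k gen(1) _ gen(2)] that by blast
qed

text \<open>The Wirtinger derivatives force the real derivative at 0 to be complex conjugation; the
  estimate is then differentiability at 0.\<close>

lemma C1_near_near_cnj:
  assumes "C1_near g 0" "g 0 = 0" "wirtinger_z g 0 = 0" "wirtinger_zbar g 0 = 1" "\<epsilon> > 0"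
  obtains d where "d > 0" "\<And>z. norm z < d \<Longrightarrow> norm (g z - cnj z) \<le> \<epsilon> * norm z"
proof -
  obtain L where L: "(g has_derivative L) (at 0)"
    using assms(1) unfolding C1_near_def by (metis centre_in_ball)
  then have fr: "frechet_derivative g (at 0) = L" by (rule frechet_derivative_at[symmetric])
  have lin: "linear L" using L has_derivative_linear by blast
  have 1: "L 1 = \<i> * L \<i>" and 2: "L 1 + \<i> * L \<i> = 2"
    using assms(3,4) by (simp_all add: wirtinger_z_def wirtinger_zbar_def fr)
  have L1: "L 1 = 1" using 1 2 by simp
  have Li: "L \<i> = - \<i>"
  proof -
    have "\<i> * (\<i> * L \<i>) = \<i>" using 1 L1 by simp
    then have "- L \<i> = \<i>" by (simp add: mult.assoc[symmetric])
    then show ?thesis by (metis minus_minus)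
  qed
  have Lz: "L z = cnj z" for z
  proof -
    have "L z = L (Re z *\<^sub>R 1 + Im z *\<^sub>R \<i>)"
      by (rule arg_cong[where f = L]) (simp add: complex_eq_iff)
    also have "\<dots> = Re z *\<^sub>R L 1 + Im z *\<^sub>R L \<i>"
      by (simp add: linear_add[OF lin] linear_cmul[OF lin] del: scaleR_conv_of_real)
    also have "\<dots> = cnj z" by (simp add: L1 Li complex_eq_iff)
    finally show ?thesis .
  qed
  have "\<exists>d>0. \<forall>y. norm (y - 0) < d \<longrightarrow> norm (g y - g 0 - L (y - 0)) \<le> \<epsilon> * norm (y - 0)"
    using L assms(5) unfolding has_derivative_at_alt by blast
  then show thesis using that by (auto simp: assms(2) Lz)
qed

text \<open>Complex linearity of the derivative along a coordinate axis makes it multiplication by a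
  number. The factor 2 keeps pairs with both entries below \<open>R'\<close> inside the ball of
  radius \<open>\<rho>\<close>.\<close>

lemma holomorphic2_slices:
  assumes "\<forall>p\<in>ball 0 \<rho>. \<exists>F'. (F has_derivative F') (at p) \<and>
      (\<forall>c a b. F' (c * a, c * b) = c * F' (a, b))"
    and "2 * R' \<le> \<rho>" "norm w < R'"
  shows "(\<lambda>v. F (v, w)) holomorphic_on ball 0 R'" "(\<lambda>v. F (w, v)) holomorphic_on ball 0 R'"
proof -
  have *: "\<exists>F'. (F has_derivative F') (at (v1, v2)) \<and> (\<forall>c a b. F' (c * a, c * b) = c * F' (a, b))"
    if "norm v1 < R'" "norm v2 < R'" for v1 v2
    using assms(1,2) that norm_Pair_le[of v1 v2] by force
  have "(\<lambda>v. F (v, w)) field_differentiable (at v)" if v: "norm v < R'" for v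
  proof -
    obtain F' where F': "(F has_derivative F') (at (v, w))"
      and lin: "\<forall>c a b. F' (c * a, c * b) = c * F' (a, b)"
      using *[OF v assms(3)] by blast
    have "((\<lambda>v. F (v, w)) has_derivative (\<lambda>h. F' (h, 0))) (at v)"
      by (rule has_derivative_compose[where f = "\<lambda>v. (v, w)" and g = F, OF _ F', simplified])
        (auto intro!: derivative_eq_intros)
    moreover have "(\<lambda>h. F' (h, 0)) = (*) (F' (1, 0))"
    proof
      show "F' (h, 0) = F' (1, 0) * h" for h
        using lin[rule_format, of h 1 0] by (simp add: mult.commute)
    qed
    ultimately show ?thesis
      unfolding field_differentiable_def has_field_derivative_def by auto
  qed
  then show "(\<lambda>v. F (v, w)) holomorphic_on ball 0 R'"
    by (auto simp: holomorphic_on_def intro: field_differentiable_at_within)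
  have "(\<lambda>v. F (w, v)) field_differentiable (at v)" if v: "norm v < R'" for v
  proof -
    obtain F' where F': "(F has_derivative F') (at (w, v))"
      and lin: "\<forall>c a b. F' (c * a, c * b) = c * F' (a, b)"
      using *[OF assms(3) v] by blast
    have "((\<lambda>v. F (w, v)) has_derivative (\<lambda>h. F' (0, h))) (at v)"
      by (rule has_derivative_compose[where f = "\<lambda>v. (w, v)" and g = F, OF _ F', simplified])
        (auto intro!: derivative_eq_intros)
    moreover have "(\<lambda>h. F' (0, h)) = (*) (F' (0, 1))"
    proof
      show "F' (0, h) = F' (0, 1) * h" for h
        using lin[rule_format, of h 0 1] by (simp add: mult.commute)
    qed
    ultimately show ?thesis
      unfolding field_differentiable_def has_field_derivative_def by auto
  qed
  then show "(\<lambda>v. F (w, v)) holomorphic_on ball 0 R'"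
    by (auto simp: holomorphic_on_def intro: field_differentiable_at_within)
qed

text \<open>The two bounds 1/20 put both \<open>g\<close> and \<open>h\<close> within
  \<open>norm z / 10\<close> of conjugation, so both carry parity structures. One inclusion composes
  \<open>F\<close> with odd functions; the other recovers \<open>g\<close> from \<open>h\<close> by
  a contraction with factor 1/2. The condition \<open>4 * r \<le> \<delta>\<close> keeps every
  iterate where \<open>F\<close> is controlled.\<close>

lemma generated_algebras_eq:
  fixes g :: "complex \<Rightarrow> complex" and F :: "complex \<times> complex \<Rightarrow> complex"
  assumes r: "0 < r" "r \<le> 1" "4 * r \<le> \<delta>"
    and F: "F \<in> generated_algebra_on (cball 0 \<delta> \<times> cball 0 \<delta>) fst snd"
    and odd: "\<And>p. p \<in> cball 0 \<delta> \<times> cball 0 \<delta> \<Longrightarrow> F (- p) = - F p"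
    and lip: "\<And>w u v. norm w \<le> \<delta> \<Longrightarrow> norm u \<le> \<delta> \<Longrightarrow> norm v \<le> \<delta> \<Longrightarrow>
        norm (F (w, u) - F (w, v)) \<le> 1/2 * norm (u - v)"
    and g: "\<And>z. norm z \<le> r \<Longrightarrow> norm (g z - cnj z) \<le> 1/20 * norm z"
    and Fg: "\<And>z. norm z \<le> r \<Longrightarrow> norm (F (z, g z)) \<le> 1/20 * norm z"
  shows "generated_algebra_on (cball 0 r) (\<lambda>z. z ^ 2) (\<lambda>z. g z ^ 2) =
         generated_algebra_on (cball 0 r) (\<lambda>z. z ^ 2) (\<lambda>z. (g z + F (z, g z)) ^ 2)"
proof -
  define D :: "complex set" where "D = cball 0 r"
  define h where "h z = g z + F (z, g z)" for z
  have h: "norm (h z - cnj z) \<le> norm z / 10" if "norm z \<le> r" for z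
    using g[OF that] Fg[OF that] norm_triangle_ineq[of "g z - cnj z" "F (z, g z)"]
    by (simp add: h_def algebra_simps)
  have bounds: "norm (g z) \<le> 2 * r" "norm (h z) \<le> 2 * r" if "norm z \<le> r" for z
    using r(1) g[OF that] h[OF that] that norm_triangle_sub[of "g z" "cnj z"] norm_triangle_sub[of "h z" "cnj z"]
      by auto
  have bounded: "g \<in> bounded_functions_on D" "h \<in> bounded_functions_on D"
    using bounds by (auto intro!: bounded_functions_onI[where M = "2 * r"] simp: D_def)
  have g': "norm (g z - cnj z) \<le> norm z / 10" if "norm z \<le> r" for z
    using g[OF that] norm_ge_zero[of z] by linarith
  define Ag where "Ag = generated_algebra_on D (\<lambda>z. z ^ 2) (\<lambda>z. g z ^ 2)"
  define Ah where "Ah = generated_algebra_on D (\<lambda>z. z ^ 2) (\<lambda>z. h z ^ 2)"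
  obtain Bg where Bg: "parity_algebra_on D Ag Bg" "(\<lambda>z. z) \<in> Bg" "g \<in> Bg"
    using obtain_parity_algebra_on_disc[OF r(2) bounded(1)[unfolded D_def] g']
    unfolding Ag_def D_def by blast
  obtain Bh where Bh: "parity_algebra_on D Ah Bh" "(\<lambda>z. z) \<in> Bh" "h \<in> Bh"
    using obtain_parity_algebra_on_disc[OF r(2) bounded(2)[unfolded D_def] h]
    unfolding Ah_def D_def by blast
  interpret G: parity_algebra_on D Ag Bg by (rule Bg)
  interpret H: parity_algebra_on D Ah Bh by (rule Bh)
  have z\<delta>: "norm z \<le> \<delta>" if "z \<in> D" for z
    using that r by (simp add: D_def)

  have "(\<lambda>z. F (z, g z)) \<in> Bg"
    using r bounds(1) z\<delta> by (intro G.odd_compose[OF F odd Bg(2,3)]) (force simp: D_def)+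
  then have "h \<in> Bg" unfolding h_def by (rule G.odd_add[OF Bg(3)])
  then have "(\<lambda>z. h z ^ 2) \<in> Ag" using G.odd_odd[of h h] by (simp add: power2_eq_square)
  then have "Ah \<subseteq> Ag"
    unfolding Ah_def
    by (intro G.generated_algebra_on_subset)
      (simp_all add: Ag_def generators_in_generated_algebra_on)

  moreover have "g \<in> Bh"
  proof -
    define u where "u = rec_nat (\<lambda>_. 0) (\<lambda>_ v z. h z - F (z, v z))"
    have u0: "u 0 = (\<lambda>_. 0)" and uS: "u (Suc n) = (\<lambda>z. h z - F (z, u n z))" for n
      by (simp_all add: u_def)
    \<comment> \<open>Iterates stay within \<open>2 * r\<close> of \<open>g\<close>, itself bounded
      by \<open>2 * r\<close>; hence the need for \<open>4 * r \<le> \<delta>\<close>.\<close>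
    have small: "norm v \<le> \<delta>" if "norm (v - g z) \<le> (1/2) ^ n * (2 * r)" "z \<in> D" for v z n
    proof -
      have "(1/2) ^ n * (2 * r) \<le> 2 * r"
        using r by (intro mult_left_le_one_le power_le_one) auto
      moreover have "norm (g z) \<le> 2 * r" using bounds(1)[of z] that(2) by (simp add: D_def)
      ultimately show ?thesis
        using that(1) r norm_triangle_sub[of v "g z"] by linarith
    qed
    have err: "norm (u n z - g z) \<le> (1/2) ^ n * (2 * r)" if z: "z \<in> D" for n z
    proof (induction n)
      case 0 then show ?case using bounds(1)[of z] z by (simp add: u0 D_def)
    next
      case (Suc n)
      \<comment> \<open>Since \<open>g z = h z - F (z, g z)\<close>, the terms \<open>h z\<close>
        cancel.\<close>
      have "norm (u (Suc n) z - g z) = norm (F (z, u n z) - F (z, g z))"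
        by (simp add: uS h_def norm_minus_commute)
      also have "\<dots> \<le> 1/2 * norm (u n z - g z)"
        using small[OF Suc z] bounds(1)[of z] z z\<delta>[OF z] r by (intro lip) (auto simp: D_def)
      also have "\<dots> \<le> 1/2 * ((1/2) ^ n * (2 * r))" using Suc by simp
      finally show ?case by simp
    qed
    have uB: "u n \<in> Bh" for n
    proof (induction n)
      case 0 then show ?case using H.odd_cmult[OF Bh(3), of 0] by (simp add: u0)
    next
      case (Suc n)
      have "(\<lambda>z. F (z, u n z)) \<in> Bh"
        using small[OF err] z\<delta> by (intro H.odd_compose[OF F odd Bh(2) Suc]) auto
      then show ?case unfolding uS by (rule H.odd_diff[OF Bh(3)])
    qed
    have "g \<in> uniform_closure_on D Bh"
    proof (rule uniform_closure_onI)
      fix \<epsilon> :: real assume "\<epsilon> > 0"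
      have "(\<lambda>n. (1/2) ^ n * (2 * r)) \<longlonglongrightarrow> 0"
        by (intro tendsto_mult_left_zero LIMSEQ_power_zero) simp
      then have "eventually (\<lambda>n. (1/2) ^ n * (2 * r) < \<epsilon>) sequentially"
        using \<open>\<epsilon> > 0\<close> by (rule order_tendstoD)
      then obtain n where n: "(1/2) ^ n * (2 * r) < \<epsilon>" by (auto simp: eventually_sequentially)
      have "norm (g z - u n z) < \<epsilon>" if "z \<in> D" for z
        using err[OF that, of n] n by (simp add: norm_minus_commute)
      then show "\<exists>p\<in>Bh. \<forall>z\<in>D. norm (g z - p z) < \<epsilon>" using uB by blast
    qed
    then show ?thesis using H.odd_closed by blast
  qed
  then have "(\<lambda>z. g z ^ 2) \<in> Ah" using H.odd_odd[of g g] by (simp add: power2_eq_square)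
  then have "Ag \<subseteq> Ah"
    unfolding Ag_def
    by (intro H.generated_algebra_on_subset)
      (simp_all add: Ah_def generators_in_generated_algebra_on)
  ultimately show ?thesis by (simp add: Ag_def Ah_def D_def h_def)
qed

section \<open>Choice of radii and reduction to the equality of algebras\<close>

theorem theorem4p1:
  fixes g :: "complex \<Rightarrow> complex" and F :: "complex \<times> complex \<Rightarrow> complex"
  assumes "C1_near g 0"
    and "g 0 = 0"
    and "wirtinger_z g 0 = 0"
    and "wirtinger_zbar g 0 = 1"
    and "separate_points_near0 (\<lambda>z. z ^ 2) (\<lambda>z. (g z) ^ 2)"
    and "holomorphic2_near0 F"
    and "odd_near0 F"
    and "bigO_cube_near0 F"
  shows "\<exists>r0>0. \<forall>r. 0 < r \<and> r < r0 \<longrightarrow>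
     (poly_algebra_dense (\<lambda>z. z ^ 2) (\<lambda>z. (g z) ^ 2) (cball 0 r) \<longleftrightarrow>
      poly_algebra_dense (\<lambda>z. z ^ 2) (\<lambda>z. (g z + F (z, g z)) ^ 2) (cball 0 r))"
proof -
  obtain \<rho>1 where \<rho>1: "\<rho>1 > 0" "\<forall>p\<in>ball 0 \<rho>1. \<exists>F'. (F has_derivative F') (at p) \<and>
      (\<forall>c a b. F' (c * a, c * b) = c * F' (a, b))"
    using assms(6) unfolding holomorphic2_near0_def by blast
  obtain \<rho>2 where \<rho>2: "\<rho>2 > 0" "\<And>p. p \<in> ball 0 \<rho>2 \<Longrightarrow> F (- p) = - F p"
    using assms(7) unfolding odd_near0_def by blast
  obtain C0 \<rho>3 where \<rho>3: "\<rho>3 > 0" "\<And>p. p \<in> ball 0 \<rho>3 \<Longrightarrow> norm (F p) \<le> C0 * norm p ^ 3"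
    using assms(8) unfolding bigO_cube_near0_def by blast
  obtain d where d: "d > 0" "\<And>z. norm z < d \<Longrightarrow> norm (g z - cnj z) \<le> 1/20 * norm z"
    using C1_near_near_cnj[OF assms(1-4), of "1/20"] by auto
  \<comment> \<open>Makes the constant positive, so that it may stand in denominators.\<close>
  define C where "C = max C0 1"
  have C: "C \<ge> 1" by (simp add: C_def)
  define \<rho> where "\<rho> = min \<rho>1 (min \<rho>2 \<rho>3)"
  have \<rho>: "\<rho> > 0" using \<rho>1 \<rho>2 \<rho>3 by (simp add: \<rho>_def)
  have FC: "norm (F (a, b)) \<le> C * x ^ 3" if "norm a + norm b \<le> x" "x < \<rho>" for a b x
  proof -
    have n: "norm (a, b) \<le> x" using that norm_Pair_le[of a b] by linarith
    then have "norm (F (a, b)) \<le> C0 * norm (a, b) ^ 3"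
      using that by (intro \<rho>3(2)) (simp add: \<rho>_def)
    also have "\<dots> \<le> C * x ^ 3"
      using C n by (intro mult_mono power_mono) (auto simp: C_def)
    finally show ?thesis .
  qed
  \<comment> \<open>The bound \<open>\<rho> / 4\<close> makes slices holomorphic up to radius
    \<open>2 * R\<close>. The other gives \<open>R \<le> 1\<close> and
    \<open>32 * C * R ^ 2 \<le> 1\<close>; with \<open>M = 8 * C * R ^ 3\<close> the Lipschitz
    constant \<open>2 * M / R\<close> is \<open>16 * C * R ^ 2\<close>, at most 1/2.\<close>
  define R where "R = min (\<rho> / 4) (1 / (32 * C))"
  have R: "R > 0" "4 * R \<le> \<rho>" "32 * C * R \<le> 1" "R \<le> 1"
  proof -
    have "R \<le> 1 / (32 * C)" by (simp add: R_def)
    also have "\<dots> \<le> 1" using C by (simp add: field_simps)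
    finally show "R \<le> 1" .
  qed (use \<rho> C in \<open>auto simp: R_def field_simps min_def\<close>)
  have sq: "32 * C * R ^ 2 \<le> 1"
    using mult_mono[OF R(3) R(4)] R(1) by (simp add: power2_eq_square mult.assoc)
  define M where "M = C * (2 * R) ^ 3"
  have M: "norm (F (a, b)) \<le> M" if "norm a \<le> R" "norm b \<le> R" for a b
    unfolding M_def using that R \<rho> by (intro FC) auto
  have lipM: "2 * M / R \<le> 1/2"
    using sq R(1) by (simp add: M_def power3_eq_cube power2_eq_square field_simps)
  have slices: "(\<lambda>v. F (v, w)) holomorphic_on ball 0 (2 * R)"
      "(\<lambda>v. F (w, v)) holomorphic_on ball 0 (2 * R)" if "norm w \<le> R" for w
    using holomorphic2_slices[OF \<rho>1(2), of "2 * R" w] that R by (auto simp: \<rho>_def)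
  have R2: "R < 2 * R" using R by simp
  \<comment> \<open>From here \<open>R/2\<close> takes the role of \<open>\<delta>\<close> in
    \<open>generated_algebras_eq\<close>.\<close>
  have FA: "F \<in> generated_algebra_on (cball 0 (R/2) \<times> cball 0 (R/2)) fst snd"
    using slices R(1) R2 M by (rule separately_holomorphic_in_generated_algebra_on)
  have odd: "F (- p) = - F p" if "p \<in> cball 0 (R/2) \<times> cball 0 (R/2)" for p
  proof (rule \<rho>2(2))
    have "norm p \<le> norm (fst p) + norm (snd p)" using norm_Pair_le[of "fst p" "snd p"] by simp
    also have "\<dots> \<le> R/2 + R/2" using that by (intro add_mono) auto
    finally show "p \<in> ball 0 \<rho>2" using R by (simp add: \<rho>_def)
  qed
  have lip: "norm (F (w, u) - F (w, v)) \<le> 1/2 * norm (u - v)"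
    if "norm w \<le> R/2" "norm u \<le> R/2" "norm v \<le> R/2" for w u v
  proof -
    have w: "norm w \<le> R" using that R by simp
    have "norm (F (w, u) - F (w, v)) \<le> 2 * M / R * norm (u - v)"
      by (rule holomorphic_lipschitz[OF slices(2)[OF w] R(1) R2 M[OF w] that(2,3)])
    also have "\<dots> \<le> 1/2 * norm (u - v)" using lipM by (rule mult_right_mono) simp
    finally show ?thesis .
  qed
  \<comment> \<open>Here \<open>d\<close> keeps \<open>g\<close> near conjugation,
    \<open>R/8\<close> gives \<open>4 * r \<le> R/2\<close>, and \<open>540 = 27 * 20\<close> makes
    \<open>27 * C * r\<close> at most 1/20.\<close>
  define r0 where "r0 = min d (min (R/8) (1 / (540 * C)))"
  show ?thesis
  proof (intro exI[of _ r0] conjI allI impI)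
    show "r0 > 0" using d R C by (simp add: r0_def)
    fix r assume "0 < r \<and> r < r0"
    then have r: "0 < r" "r < d" "8 * r \<le> R" "540 * C * r \<le> 1"
      using C by (auto simp: r0_def field_simps)
    have Fg: "norm (F (z, g z)) \<le> 1/20 * norm z" if z: "norm z \<le> r" for z
    proof -
      have "norm (g z) \<le> 2 * norm z"
        using d(2)[of z] z r norm_triangle_sub[of "g z" "cnj z"] norm_ge_zero[of z]
        unfolding complex_mod_cnj by linarith
      \<comment> \<open>\<open>norm z + norm (g z)\<close> is at most \<open>3 * norm z\<close>. Of
        the three factors \<open>norm z\<close> in the cube, one is then bounded by
        \<open>r\<close>, one by 1, and one is kept.\<close>
      then have "norm (F (z, g z)) \<le> C * (3 * norm z) ^ 3"
        using z r R \<rho> by (intro FC) auto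
      also have "\<dots> = 27 * C * norm z * norm z * norm z" by (simp add: power3_eq_cube)
      also have "\<dots> \<le> 27 * C * r * 1 * norm z"
        using z r R C by (intro mult_right_mono mult_mono) auto
      also have "\<dots> \<le> 1/20 * norm z"
        using r by (intro mult_right_mono) auto
      finally show ?thesis .
    qed
    have "generated_algebra_on (cball 0 r) (\<lambda>z. z ^ 2) (\<lambda>z. g z ^ 2) =
        generated_algebra_on (cball 0 r) (\<lambda>z. z ^ 2) (\<lambda>z. (g z + F (z, g z)) ^ 2)"
      by (rule generated_algebras_eq[OF _ _ _ FA odd lip _ Fg])
        (use r R d(2) in auto)
    then show "poly_algebra_dense (\<lambda>z. z ^ 2) (\<lambda>z. (g z) ^ 2) (cball 0 r) \<longleftrightarrow>
      poly_algebra_dense (\<lambda>z. z ^ 2) (\<lambda>z. (g z + F (z, g z)) ^ 2) (cball 0 r)"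
      by (simp only: poly_algebra_dense_iff)
  qed
qed

end
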